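(* Let $I\subseteq S=\mathbb{K}[x_1,\dots,x_n]$ be a nice ideal, let $r=|G(I)|$, and let $\alpha$ denote the product of all variables in $\operatorname{supp}(I)$. Then $\mathrm{type}(I)=1$ if and only if there exists a subset $A\subseteq\operatorname{supp}(I)$ with $|A|=r$ such that $I$ is generated by the monomials $\dfrac{\alpha}{x}$ for all $x\in A$.
   Context: $S=\mathbb{K}[x_1,\dots,x_n]$ is the polynomial ring over a field $\mathbb{K}$. For a monomial ideal $I$, $G(I)$ is its set of minimal monomial generators. For a monomial $u$, $\operatorname{supp}(u)$ is the set of variables dividing $u$, and $\operatorname{supp}(I)=\bigcup_{u\in G(I)}\operatorname{supp}(u)$. A monomial ideal has a $d$-linear resolution if its graded Betti numbers satisfy $\beta_{i,j}(I)=0$ for all $i,j$ with $j-i\neq d$; it has a linear resolution if this holds for some $d\ge 1$. A nice ideal is a squarefree monomial ideal of projective dimension $1$ (as an $S$-module) that has a linear resolution; such an ideal has $r=|G(I)|\ge 2$ minimal generators, all of the same degree $d$. A nice ideal $I$ generated in degree $d$ is of type $t$, written $\mathrm{type}(I)=t$, if $|\operatorname{supp}(I)|=d+t$. *)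

theory Defs
  imports Complex_Main "HOL-Library.Poly_Mapping" "HOL-Library.Extended_Nat"
begin

text \<open>
  The polynomial ring in the variables \<open>'x\<close> (a finite type, so the number of variables is the
  cardinality of \<open>'x\<close>) is the monoid algebra of exponent vectors.  A monomial is represented by
  its exponent vector \<open>u\<close>; the corresponding ring element is \<open>xpow u\<close>.
\<close>

type_synonym 'x monomial = "'x \<Rightarrow>\<^sub>0 nat"
type_synonym ('x, 'k) mpoly = "('x \<Rightarrow>\<^sub>0 nat) \<Rightarrow>\<^sub>0 'k"

definition xpow :: "'x monomial \<Rightarrow> ('x, 'k::comm_ring_1) mpoly" where
  "xpow u = Poly_Mapping.single u 1"

definition mdeg :: "'x monomial \<Rightarrow> nat" where
  "mdeg u = (\<Sum>x\<in>Poly_Mapping.keys u. Poly_Mapping.lookup u x)"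

text \<open>
  A commutative ring as a module over itself: \<open>ideal.subspace\<close> are the ideals and \<open>ideal.span\<close>
  is the ideal generated by a set.
\<close>

global_interpretation ideal: module "(*) :: 'a::comm_ring_1 \<Rightarrow> 'a \<Rightarrow> 'a"
  by standard (simp_all add: algebra_simps)

declare ideal.scale_scale [simp del]  (* loops with the associativity rule in algebra_simps *)


section \<open>Monomial ideals\<close>

definition monomial_ideal :: "('x, 'k::comm_ring_1) mpoly set \<Rightarrow> bool" where
  "monomial_ideal I \<longleftrightarrow> (\<exists>M. I = ideal.span (xpow ` M))"

text \<open>
  The minimal monomial generators are the monomials of \<open>I\<close> that are minimal with respect to
  divisibility.  Lemmas \<open>span_min_gens\<close> and \<open>min_gens_least\<close> below show that, for a monomial
  ideal, this is the least set of monomials generating it.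
\<close>

definition min_gens :: "('x, 'k::comm_ring_1) mpoly set \<Rightarrow> 'x monomial set" where
  "min_gens I = {u. xpow u \<in> I \<and>
     (\<forall>v. xpow v \<in> I \<and> (xpow v :: ('x, 'k) mpoly) dvd xpow u \<longrightarrow> v = u)}"

definition ideal_supp :: "('x, 'k::comm_ring_1) mpoly set \<Rightarrow> 'x set" where
  "ideal_supp I = (\<Union>u\<in>min_gens I. Poly_Mapping.keys u)"

definition squarefree_monomial_ideal :: "('x, 'k::comm_ring_1) mpoly set \<Rightarrow> bool" where
  "squarefree_monomial_ideal I \<longleftrightarrow>
     monomial_ideal I \<and> (\<forall>u\<in>min_gens I. \<forall>x. Poly_Mapping.lookup u x \<le> 1)"

lemma xpow_dvd_iff:
  "(xpow v :: ('x, 'k::comm_ring_1) mpoly) dvd xpow u \<longleftrightarrow> (\<exists>w. u = v + w)"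
proof
  assume "(xpow v :: ('x, 'k) mpoly) dvd xpow u"
  then obtain q :: "('x, 'k) mpoly" where q: "xpow u = xpow v * q" by (auto simp: dvd_def)
  have "u \<in> Poly_Mapping.keys (xpow u :: ('x, 'k) mpoly)" by (simp add: xpow_def)
  then show "\<exists>w. u = v + w"
    using keys_mult[of "xpow v" q] unfolding q by (auto simp: xpow_def)
next
  assume "\<exists>w. u = v + w"
  then obtain w where "u = v + w" ..
  then have "(xpow u :: ('x, 'k) mpoly) = xpow v * xpow w"
    by (simp add: xpow_def mult_single)
  then show "(xpow v :: ('x, 'k) mpoly) dvd xpow u" by simp
qed

lemma keys_span_xpow:
  assumes "p \<in> ideal.span (xpow ` M)" "w \<in> Poly_Mapping.keys (p :: ('x, 'k::comm_ring_1) mpoly)"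
  shows "\<exists>v\<in>M. \<exists>t. w = v + t"
proof -
  let ?T = "{p :: ('x, 'k) mpoly. \<forall>w\<in>Poly_Mapping.keys p. \<exists>v\<in>M. \<exists>t. w = v + t}"
  have sub: "ideal.subspace ?T"
  proof (rule ideal.subspaceI)
    fix p q assume "p \<in> ?T" "q \<in> ?T"
    then show "p + q \<in> ?T" using keys_add[of p q] by blast
  next
    fix c p assume p: "p \<in> ?T"
    have "\<exists>v\<in>M. \<exists>t. w = v + t" if "w \<in> Poly_Mapping.keys (c * p)" for w
    proof -
      from that obtain a b where "w = a + b" "b \<in> Poly_Mapping.keys p" using keys_mult[of c p] by blast
      moreover from this p obtain v t where "v \<in> M" "b = v + t" by blast
      ultimately have "w = v + (a + t)" by (simp add: algebra_simps)
      with \<open>v \<in> M\<close> show ?thesis by blast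
    qed
    then show "c * p \<in> ?T" by blast
  qed simp
  have "xpow v \<in> ?T" if "v \<in> M" for v
    using that by (auto simp: xpow_def intro!: bexI[of _ v] exI[of _ 0])
  then have "ideal.span (xpow ` M) \<subseteq> ?T"
    by (intro ideal.span_minimal sub) blast
  with assms show ?thesis by blast
qed

lemma mdeg_eq: "finite B \<Longrightarrow> Poly_Mapping.keys u \<subseteq> B \<Longrightarrow> mdeg u = (\<Sum>x\<in>B. Poly_Mapping.lookup u x)"
  unfolding mdeg_def by (rule sum.mono_neutral_left) (auto simp: in_keys_iff)

lemma mdeg_add: "mdeg (u + v) = mdeg u + mdeg v"
proof -
  have "mdeg w = (\<Sum>x\<in>Poly_Mapping.keys u \<union> Poly_Mapping.keys v. Poly_Mapping.lookup w x)"
    if "w \<in> {u, v, u + v}" for w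
    using that keys_add[of u v] by (intro mdeg_eq) auto
  then show ?thesis by (simp add: lookup_add sum.distrib)
qed

lemma mdeg_eq_0_iff: "mdeg u = 0 \<longleftrightarrow> u = 0"
  by (auto simp: mdeg_def in_keys_iff intro!: poly_mapping_eqI)

lemma span_min_gens:
  assumes "monomial_ideal (I :: ('x, 'k::comm_ring_1) mpoly set)"
  shows "ideal.span (xpow ` min_gens I) = I"
proof -
  from assms obtain M where I: "I = ideal.span (xpow ` M)" by (auto simp: monomial_ideal_def)
  have sub: "ideal.subspace I" unfolding I by (rule ideal.subspace_span)
  have "(xpow u :: ('x, 'k) mpoly) \<in> I \<Longrightarrow> (xpow u :: ('x, 'k) mpoly) \<in> ideal.span (xpow ` min_gens I)" for u
  proof (induction "mdeg u" arbitrary: u rule: less_induct)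
    case less
    show ?case
    proof (cases "u \<in> min_gens I")
      case True
      then show ?thesis by (intro ideal.span_base) blast
    next
      case False
      with less.prems obtain v
        where v: "(xpow v :: ('x, 'k) mpoly) \<in> I" "(xpow v :: ('x, 'k) mpoly) dvd xpow u" "v \<noteq> u"
        unfolding min_gens_def by blast
      then obtain w where w: "u = v + w" unfolding xpow_dvd_iff by blast
      with v have "mdeg v < mdeg u" using mdeg_eq_0_iff[of w] by (auto simp: mdeg_add)
      from less.hyps[OF this v(1)] have "(xpow v :: ('x, 'k) mpoly) \<in> ideal.span (xpow ` min_gens I)" .
      with v(2) show ?thesis
        by (auto simp: dvd_def mult.commute intro: ideal.span_scale)
    qed
  qed
  moreover have "xpow ` M \<subseteq> I" unfolding I by (rule ideal.span_superset)
  ultimately have "(xpow ` M :: ('x, 'k) mpoly set) \<subseteq> ideal.span (xpow ` min_gens I)"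
    by blast
  then have "I \<subseteq> ideal.span (xpow ` min_gens I)"
    by (subst I) (rule ideal.span_minimal[OF _ ideal.subspace_span])
  moreover have "ideal.span (xpow ` min_gens I) \<subseteq> I"
    by (rule ideal.span_minimal[OF _ sub]) (auto simp: min_gens_def)
  ultimately show ?thesis by (rule equalityI[rotated])
qed

lemma min_gens_least:
  assumes "ideal.span (xpow ` M) = (I :: ('x, 'k::comm_ring_1) mpoly set)"
  shows "min_gens I \<subseteq> M"
proof
  fix u assume u: "u \<in> min_gens I"
  then have "(xpow u :: ('x, 'k) mpoly) \<in> ideal.span (xpow ` M)"
    unfolding assms by (simp add: min_gens_def)
  then obtain v t where v: "v \<in> M" "u = v + t"
    using keys_span_xpow[of "xpow u" M u] by (auto simp: xpow_def)
  then have "(xpow v :: ('x, 'k) mpoly) \<in> I" unfolding assms[symmetric] by (intro ideal.span_base) blast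
  moreover have "(xpow v :: ('x, 'k) mpoly) dvd xpow u" using v(2) by (auto simp: xpow_dvd_iff)
  ultimately have "v = u" using u by (simp add: min_gens_def)
  with v(1) show "u \<in> M" by simp
qed


section \<open>Resolutions\<close>

text \<open>
  The free module of countable rank over a commutative ring is the type of finitely supported
  sequences, with standard basis \<open>basis_vec k\<close>.
\<close>

definition vscale :: "'a::comm_ring_1 \<Rightarrow> (nat \<Rightarrow>\<^sub>0 'a) \<Rightarrow> (nat \<Rightarrow>\<^sub>0 'a)" where
  "vscale c v = Poly_Mapping.map ((*) c) v"

definition basis_vec :: "nat \<Rightarrow> (nat \<Rightarrow>\<^sub>0 'a::comm_ring_1)" where
  "basis_vec k = Poly_Mapping.single k 1"

lemma lookup_vscale: "Poly_Mapping.lookup (vscale c v) k = c * Poly_Mapping.lookup v k"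
  by (simp add: vscale_def Poly_Mapping.map.rep_eq when_def)

global_interpretation freemod: module "vscale :: 'a::comm_ring_1 \<Rightarrow> _"
  by standard
    (rule poly_mapping_eqI,
      simp add: lookup_vscale lookup_add distrib_left distrib_right mult.assoc)+

text \<open>
  \<open>resolution I P eps delta\<close> says that
  \<open>... \<rightarrow> P 2 \<rightarrow> P 1 \<rightarrow> P 0 \<rightarrow> I \<rightarrow> 0\<close> is exact, where \<open>eps\<close> is the map \<open>P 0 \<rightarrow> I\<close> and \<open>delta i\<close>
  the map \<open>P (i + 1) \<rightarrow> P i\<close>.  All maps are defined on the ambient free module; this is no
  restriction when the modules \<open>P i\<close> are direct summands of it, since a linear map on a summand
  extends by zero on a complement.
\<close>

definition resolution ::
  "'a::comm_ring_1 set \<Rightarrow> (nat \<Rightarrow> (nat \<Rightarrow>\<^sub>0 'a) set) \<Rightarrow> ((nat \<Rightarrow>\<^sub>0 'a) \<Rightarrow> 'a)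
     \<Rightarrow> (nat \<Rightarrow> (nat \<Rightarrow>\<^sub>0 'a) \<Rightarrow> (nat \<Rightarrow>\<^sub>0 'a)) \<Rightarrow> bool" where
  "resolution I P eps delta \<longleftrightarrow>
     module_hom vscale (*) eps \<and> (\<forall>i. module_hom vscale vscale (delta i)) \<and>
     eps ` P 0 = I \<and>
     delta 0 ` P 1 = {v \<in> P 0. eps v = 0} \<and>
     (\<forall>i. delta (Suc i) ` P (Suc (Suc i)) = {v \<in> P (Suc i). delta i v = 0})"

text \<open>
  A projective module is a direct summand of a free module.  Up to isomorphism, the direct
  summands of the free module of countable rank are exactly the countably generated projective
  modules, which suffice for resolving an ideal of a polynomial ring in finitely many variables.
\<close>

definition projective :: "(nat \<Rightarrow>\<^sub>0 'a::comm_ring_1) set \<Rightarrow> bool" where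
  "projective P \<longleftrightarrow> freemod.subspace P \<and>
     (\<exists>Q. freemod.subspace Q \<and> P \<inter> Q = {0} \<and> {p + q | p q. p \<in> P \<and> q \<in> Q} = UNIV)"

definition proj_dim :: "'a::comm_ring_1 set \<Rightarrow> enat" where
  "proj_dim I = Inf {enat n | n P eps delta.
     (\<forall>i. projective (P i)) \<and> resolution I P eps delta \<and> (\<forall>i>n. P i = {0})}"

text \<open>\<open>homogeneous e p\<close>: the polynomial \<open>p\<close> lies in the graded piece of degree \<open>e\<close>.\<close>

definition homogeneous :: "int \<Rightarrow> ('x, 'k::comm_ring_1) mpoly \<Rightarrow> bool" where
  "homogeneous e p \<longleftrightarrow> (\<forall>u\<in>Poly_Mapping.keys p. int (mdeg u) = e)"

definition irrelevant_ideal :: "('x, 'k::comm_ring_1) mpoly set" where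
  "irrelevant_ideal = ideal.span (range (\<lambda>x. xpow (Poly_Mapping.single x 1)))"

definition free_on :: "nat \<Rightarrow> (nat \<Rightarrow>\<^sub>0 'a::comm_ring_1) set" where
  "free_on b = freemod.span (basis_vec ` {..<b})"

text \<open>
  A minimal graded free resolution of \<open>I\<close> whose \<open>i\<close>-th module is the direct sum of the shifted
  modules \<open>S(- a i k)\<close>, \<open>k < b i\<close>, i.e. its basis vector \<open>basis_vec k\<close> has degree \<open>a i k\<close>.  The
  second and third conjuncts say that the maps preserve degrees, the last one that each
  \<open>F (i + 1) \<rightarrow> F i\<close> has image in \<open>(x\<^sub>1, \<dots>, x\<^sub>n) F i\<close>.
\<close>

definition minimal_graded_free_resolution ::
  "('x, 'k::comm_ring_1) mpoly set \<Rightarrow> (nat \<Rightarrow> nat) \<Rightarrow> (nat \<Rightarrow> nat \<Rightarrow> int)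
     \<Rightarrow> ((nat \<Rightarrow>\<^sub>0 ('x, 'k) mpoly) \<Rightarrow> ('x, 'k) mpoly)
     \<Rightarrow> (nat \<Rightarrow> (nat \<Rightarrow>\<^sub>0 ('x, 'k) mpoly) \<Rightarrow> (nat \<Rightarrow>\<^sub>0 ('x, 'k) mpoly)) \<Rightarrow> bool" where
  "minimal_graded_free_resolution I b a eps delta \<longleftrightarrow>
     resolution I (\<lambda>i. free_on (b i)) eps delta \<and>
     (\<forall>k<b 0. homogeneous (a 0 k) (eps (basis_vec k))) \<and>
     (\<forall>i. \<forall>k<b (Suc i). \<forall>l<b i.
        homogeneous (a (Suc i) k - a i l) (Poly_Mapping.lookup (delta i (basis_vec k)) l)) \<and>
     (\<forall>i. \<forall>v\<in>free_on (b (Suc i)). \<forall>l.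
        Poly_Mapping.lookup (delta i v) l \<in> irrelevant_ideal)"

text \<open>
  The graded Betti number \<open>\<beta>\<^sub>i\<^sub>,\<^sub>j(I)\<close> is the number of summands \<open>S(-j)\<close> in the \<open>i\<close>-th module of
  the minimal graded free resolution of \<open>I\<close>.  That resolution is unique up to isomorphism, so, for a
  homogeneous ideal in finitely many variables over a field, the infimum is over a set with one
  element; it is used in place of a choice of resolution.
\<close>

definition graded_betti :: "('x, 'k::comm_ring_1) mpoly set \<Rightarrow> nat \<Rightarrow> int \<Rightarrow> enat" where
  "graded_betti I i j = Inf {enat (card {k. k < b i \<and> a i k = j}) | b a eps delta.
     minimal_graded_free_resolution I b a eps delta}"

definition linear_resolution_deg :: "nat \<Rightarrow> ('x, 'k::comm_ring_1) mpoly set \<Rightarrow> bool" where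
  "linear_resolution_deg d I \<longleftrightarrow> (\<forall>i j. j - int i \<noteq> int d \<longrightarrow> graded_betti I i j = 0)"

definition linear_resolution :: "('x, 'k::comm_ring_1) mpoly set \<Rightarrow> bool" where
  "linear_resolution I \<longleftrightarrow> (\<exists>d\<ge>1. linear_resolution_deg d I)"


section \<open>Nice ideals\<close>

definition nice_ideal :: "('x, 'k::field) mpoly set \<Rightarrow> bool" where
  "nice_ideal I \<longleftrightarrow> squarefree_monomial_ideal I \<and> proj_dim I = 1 \<and> linear_resolution I"

text \<open>For a nice ideal \<open>min_gens I\<close> is nonempty, so the degree \<open>d\<close> is unique.\<close>

definition has_type :: "('x, 'k::field) mpoly set \<Rightarrow> nat \<Rightarrow> bool" where
  "has_type I t \<longleftrightarrow> (\<exists>d. (\<forall>u\<in>min_gens I. mdeg u = d) \<and> card (ideal_supp I) = d + t)"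

end

theory Submission
  imports Defs
begin

text \<open>
  A squarefree monomial is determined by its support, and its degree is the size of that support.
  So, if \<open>I\<close> is generated in degree \<open>d\<close>, then \<open>type(I) = 1\<close> says that the support of each minimal
  generator is \<open>supp(I)\<close> with exactly one variable removed (lemma
  \<open>squarefree_eq_squarefree_mon_remove\<close>), that is, each minimal generator is some \<open>\<alpha> / x\<close>.  Since
  \<open>x \<mapsto> \<alpha> / x\<close> is injective, the removed variables form a set \<open>A\<close> of size \<open>|G(I)|\<close>.

  Conversely, if the monomials \<open>\<alpha> / x\<close> with \<open>x \<in> A\<close> generate \<open>I\<close>, then the minimal generators are
  among them and have degree \<open>|supp(I)| - 1\<close>.  This gives \<open>type(I) = 1\<close> unless \<open>supp(I)\<close> is empty.
  In that case \<open>A\<close> is empty and \<open>I\<close> is the zero ideal, whose projective dimension is \<open>0\<close> and not \<open>1\<close>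
  (lemma \<open>proj_dim_zero_ideal\<close>).
\<close>

definition squarefree_mon :: "'x set \<Rightarrow> 'x monomial" where
  "squarefree_mon B = (\<Sum>x\<in>B. Poly_Mapping.single x 1)"

lemma lookup_squarefree_mon:
  "finite B \<Longrightarrow> Poly_Mapping.lookup (squarefree_mon B) y = (if y \<in> B then 1 else 0)"
  by (simp add: squarefree_mon_def lookup_sum lookup_single when_def)

lemma keys_squarefree_mon: "finite B \<Longrightarrow> Poly_Mapping.keys (squarefree_mon B) = B"
  by (auto simp: in_keys_iff lookup_squarefree_mon split: if_splits)

lemma mdeg_squarefree_mon: "finite B \<Longrightarrow> mdeg (squarefree_mon B) = card B"
  by (simp add: mdeg_def keys_squarefree_mon lookup_squarefree_mon)

lemma squarefree_mon_minus_single: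
  assumes "finite B"
  shows "squarefree_mon B - Poly_Mapping.single x 1 = squarefree_mon (B - {x})"
  using assms
  by (intro poly_mapping_eqI) (auto simp: lookup_squarefree_mon lookup_minus lookup_single when_def)

lemma squarefree_eq_squarefree_mon_keys:
  assumes "\<forall>x. Poly_Mapping.lookup u x \<le> 1"
  shows "u = squarefree_mon (Poly_Mapping.keys u)"
proof (rule poly_mapping_eqI)
  fix x
  have "Poly_Mapping.lookup u x \<le> 1" using assms ..
  then show "Poly_Mapping.lookup u x = Poly_Mapping.lookup (squarefree_mon (Poly_Mapping.keys u)) x"
    by (auto simp: lookup_squarefree_mon in_keys_iff)
qed

text \<open>The complement of the support in \<open>B\<close> has size one, hence is a single variable.\<close>

lemma squarefree_eq_squarefree_mon_remove:
  assumes sf: "\<forall>x. Poly_Mapping.lookup u x \<le> 1"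
    and B: "finite B" "Poly_Mapping.keys u \<subseteq> B" "card B = mdeg u + 1"
  shows "\<exists>x\<in>B. u = squarefree_mon (B - {x})"
proof -
  note u = squarefree_eq_squarefree_mon_keys[OF sf]
  have "mdeg u = card (Poly_Mapping.keys u)"
    by (subst u) (simp add: mdeg_squarefree_mon)
  with B have "card (B - Poly_Mapping.keys u) = 1"
    by (simp add: card_Diff_subset)
  then obtain x where x: "B - Poly_Mapping.keys u = {x}"
    by (auto simp: card_1_singleton_iff)
  with B(2) have "Poly_Mapping.keys u = B - {x}" "x \<in> B" by auto
  with u show ?thesis by metis
qed

lemma inj_on_squarefree_mon_remove:
  assumes "finite B"
  shows "inj_on (\<lambda>x. squarefree_mon (B - {x})) B"
proof (rule inj_onI)
  fix x y
  assume "x \<in> B" "y \<in> B" and eq: "squarefree_mon (B - {x}) = squarefree_mon (B - {y})"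
  from arg_cong[OF eq, of Poly_Mapping.keys] assms have "B - {x} = B - {y}"
    by (simp add: keys_squarefree_mon)
  with \<open>x \<in> B\<close> \<open>y \<in> B\<close> show "x = y" by blast
qed

text \<open>The zero ideal is resolved by zero modules.\<close>

lemma proj_dim_zero_ideal: "proj_dim {0 :: 'a::comm_ring_1} = 0"
proof -
  let ?P = "\<lambda>_::nat. {0 :: nat \<Rightarrow>\<^sub>0 'a}"
  have "projective {0 :: nat \<Rightarrow>\<^sub>0 'a}"
    unfolding projective_def
    by (intro conjI exI[of _ UNIV]) (auto intro: freemod.subspace_UNIV)
  moreover have "resolution {0} ?P (\<lambda>_. 0) (\<lambda>_ _. 0)"
    unfolding resolution_def
    by (auto simp: module_hom_iff ideal.module_axioms freemod.module_axioms)
  ultimately have "proj_dim {0 :: 'a} \<le> enat 0"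
    unfolding proj_dim_def
    by (intro Inf_lower CollectI exI[of _ 0] exI[of _ ?P] exI[of _ "\<lambda>_. 0"] exI[of _ "\<lambda>_ _. 0"])
      simp
  then show ?thesis by (simp add: zero_enat_def[symmetric])
qed

lemma nice_ideal_min_gens_nonempty:
  assumes "nice_ideal I"
  shows "min_gens I \<noteq> {}"
proof
  assume empty: "min_gens I = {}"
  have "monomial_ideal I"
    using assms by (simp add: nice_ideal_def squarefree_monomial_ideal_def)
  from span_min_gens[OF this] empty have "I = {0}" by simp
  with assms show False by (simp add: nice_ideal_def proj_dim_zero_ideal)
qed

theorem proposition3p7:
  fixes I :: "('x::finite, 'k::field) mpoly set"
    and r :: nat
    and \<alpha> :: "'x monomial"
  assumes "nice_ideal I"
    and "r = card (min_gens I)"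
    and "\<alpha> = (\<Sum>x\<in>ideal_supp I. Poly_Mapping.single x 1)"
  shows "has_type I 1 \<longleftrightarrow>
    (\<exists>A. A \<subseteq> ideal_supp I \<and> card A = r \<and>
      I = ideal.span ((\<lambda>x. xpow (\<alpha> - Poly_Mapping.single x 1)) ` A))"
proof -
  let ?B = "ideal_supp I"
  let ?m = "\<lambda>x. squarefree_mon (?B - {x})"
  have monomial: "monomial_ideal I"
    and sf: "\<And>u. u \<in> min_gens I \<Longrightarrow> \<forall>x. Poly_Mapping.lookup u x \<le> 1"
    using assms(1) by (auto simp: nice_ideal_def squarefree_monomial_ideal_def)
  have quotient: "\<alpha> - Poly_Mapping.single x 1 = ?m x" for x
    unfolding assms(3) squarefree_mon_def[symmetric]
    by (rule squarefree_mon_minus_single) simp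
  have image: "(\<lambda>x. xpow (\<alpha> - Poly_Mapping.single x 1)) ` A = xpow ` ?m ` A" for A
    unfolding quotient image_image ..
  show ?thesis
    unfolding image
  proof
    assume "has_type I 1"
    then obtain d where d: "\<forall>u\<in>min_gens I. mdeg u = d" "card ?B = d + 1"
      by (auto simp: has_type_def)
    have gens: "\<exists>x\<in>?B. u = ?m x" if "u \<in> min_gens I" for u
      using that d sf[OF that]
      by (intro squarefree_eq_squarefree_mon_remove) (auto simp: ideal_supp_def)
    define A where "A = {x \<in> ?B. ?m x \<in> min_gens I}"
    have mA: "?m ` A = min_gens I"
      using gens by (auto simp: A_def)
    have "inj_on ?m A"
      by (rule inj_on_subset[OF inj_on_squarefree_mon_remove]) (auto simp: A_def)
    then have "card A = r"
      using card_image[of ?m A] by (simp add: mA assms(2))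
    moreover have "I = ideal.span (xpow ` ?m ` A)"
      by (simp add: mA span_min_gens[OF monomial])
    ultimately show "\<exists>A. A \<subseteq> ?B \<and> card A = r \<and> I = ideal.span (xpow ` ?m ` A)"
      by (intro exI[of _ A]) (auto simp: A_def)
  next
    assume "\<exists>A. A \<subseteq> ?B \<and> card A = r \<and> I = ideal.span (xpow ` ?m ` A)"
    then obtain A where A: "A \<subseteq> ?B" "I = ideal.span (xpow ` ?m ` A)" by blast
    have gens: "min_gens I \<subseteq> ?m ` A"
      using A(2)[symmetric] by (rule min_gens_least)
    with nice_ideal_min_gens_nonempty[OF assms(1)] A(1) have "?B \<noteq> {}" by auto
    then have "card ?B \<noteq> 0" by simp
    then have "card ?B = card ?B - 1 + 1" by linarith
    moreover have "mdeg u = card ?B - 1" if "u \<in> min_gens I" for u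
    proof -
      from that gens obtain x where "x \<in> A" "u = ?m x" by blast
      with A(1) show ?thesis by (auto simp: mdeg_squarefree_mon card_Diff_singleton)
    qed
    ultimately show "has_type I 1"
      unfolding has_type_def by blast
  qed
qed

end
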